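(* $\left\{(r_0,r_1)\in\mathbb{R}^2 \mid -1<r_0-r_1\le -\tfrac12,\ r_1\ge 1+\sqrt5,\ r_1^2\ge 4r_0\right\}\subset\mathcal{D}_2^{( * )}$.
   Context: For $\mathbf{r}=(r_0,r_1)\in\mathbb{R}^2$, the two-dimensional shift radix system is the map $\tau_{\mathbf{r}}:\mathbb{Z}^2\to\mathbb{Z}^2$, $\tau_{\mathbf{r}}(a_0,a_1)=(a_1,-\lfloor r_0a_0+r_1a_1\rfloor)$. The orbit of $(a_0,a_1)$ is identified with the integer sequence $(a_n)_{n\ge 0}$ where $a_{n+2}=-\lfloor r_0a_n+r_1a_{n+1}\rfloor$ for $n\ge0$. An orbit is ultimately periodic if there are $n_0\ge 0$, $p>0$ with $a_{n+p}=a_n$ for all $n\ge n_0$; it ends up in the trivial cycle if $a_n=0$ for all sufficiently large $n$. $\mathcal{D}_2^{( * )}$ is the set of all $\mathbf{r}\in\mathbb{R}^2$ such that each ultimately periodic orbit of $\tau_{\mathbf{r}}$ ends up in the trivial cycle. *)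

theory Defs
  imports Complex_Main
begin

definition srs :: "real \<times> real \<Rightarrow> int \<times> int \<Rightarrow> int \<times> int" where
  "srs r a = (snd a, - \<lfloor>fst r * real_of_int (fst a) + snd r * real_of_int (snd a)\<rfloor>)"

text \<open>Consecutive points of an orbit overlap in one coordinate, so the orbit of \<open>a\<close> is
  determined by the integer sequence of first coordinates.\<close>

definition srs_orbit :: "real \<times> real \<Rightarrow> int \<times> int \<Rightarrow> nat \<Rightarrow> int" where
  "srs_orbit r a n = fst ((srs r ^^ n) a)"

lemma srs_orbit_0: "srs_orbit r a 0 = fst a"
  by (simp add: srs_orbit_def)

lemma srs_orbit_1: "srs_orbit r a (Suc 0) = snd a"
  by (simp add: srs_orbit_def srs_def)

lemma srs_orbit_rec:
  "srs_orbit r a (n + 2) =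
     - \<lfloor>fst r * real_of_int (srs_orbit r a n) + snd r * real_of_int (srs_orbit r a (n + 1))\<rfloor>"
  by (simp add: srs_orbit_def srs_def)

definition ultimately_periodic :: "(nat \<Rightarrow> int) \<Rightarrow> bool" where
  "ultimately_periodic s \<longleftrightarrow> (\<exists>n0. \<exists>p>0. \<forall>n\<ge>n0. s (n + p) = s n)"

definition ends_in_trivial_cycle :: "(nat \<Rightarrow> int) \<Rightarrow> bool" where
  "ends_in_trivial_cycle s \<longleftrightarrow> (\<exists>n0. \<forall>n\<ge>n0. s n = 0)"

definition D2_star :: "(real \<times> real) set" where
  "D2_star = {r. \<forall>a. ultimately_periodic (srs_orbit r a) \<longrightarrow> ends_in_trivial_cycle (srs_orbit r a)}"

end

theory Submission
  imports Defs
begin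

text \<open>
  Let \<open>-\<alpha>\<close> and \<open>-\<beta>\<close>, with \<open>\<alpha> \<le> \<beta>\<close>, be the roots of \<open>x\<^sup>2 + r\<^sub>1 x + r\<^sub>0\<close>. The hypotheses give
  \<open>(\<alpha> - 1) (\<beta> - 1) = 1 - r\<^sub>1 + r\<^sub>0 > 0\<close>, and \<open>\<beta> \<ge> r\<^sub>1 / 2\<close> is at least the golden ratio, so that
  \<open>\<alpha> > 1\<close> and \<open>\<beta>\<^sup>2 - 1 \<ge> \<beta>\<close>. Put \<open>d\<^sub>n = a\<^sub>n\<^sub>+\<^sub>1 + \<alpha> a\<^sub>n\<close>; then \<open>d\<^sub>n\<^sub>+\<^sub>1 + \<beta> d\<^sub>n \<in> [0, 1)\<close>.
  A value of \<open>d\<close> outside \<open>[-1, 1]\<close> would be magnified forever, so on a cycle \<open>\<bar>d\<^sub>n\<bar> \<le> 1\<close>. Hence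
  \<open>\<bar>a\<^sub>n\<^sub>+\<^sub>1\<bar> \<ge> \<alpha> \<bar>a\<^sub>n\<bar> - 1\<close>, and as the \<open>a\<^sub>n\<close> are integers, \<open>\<bar>a\<^sub>n\<bar>\<close> is nondecreasing, thus constant.
  The cycle is therefore \<open>m, -m, m, \<dots>\<close>, and \<open>\<plusminus>m (1 - r\<^sub>1 + r\<^sub>0) \<in> [0, 1)\<close> for both signs
  forces \<open>m = 0\<close>.
\<close>

lemma periodic_mult:
  fixes f :: "nat \<Rightarrow> 'a" and n0 p :: nat
  assumes "\<And>n. n \<ge> n0 \<Longrightarrow> f (n + p) = f n" and "n \<ge> n0"
  shows "f (n + k * p) = f n"
proof (induction k)
  case (Suc k)
  have "f (n + k * p + p) = f (n + k * p)"
    using assms by simp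
  with Suc show ?case
    by (simp add: ac_simps)
qed simp

lemma periodic_expanding_bounded:
  fixes d :: "nat \<Rightarrow> real"
  assumes per: "\<And>n. n \<ge> n0 \<Longrightarrow> d (n + p) = d n" and "p > 0"
    and rec: "\<And>n. 0 \<le> d (Suc n) + \<beta> * d n \<and> d (Suc n) + \<beta> * d n < 1"
    and \<beta>: "\<beta> > 1" "\<beta>\<^sup>2 - 1 \<ge> \<beta>" and "n \<ge> n0"
  shows "\<bar>d n\<bar> \<le> 1"
proof -
  \<comment> \<open>One step roughly flips the sign, so growth is measured over two; eliminating
    \<open>d (Suc m)\<close> gives
    \<open>d (m + 2) > \<beta>\<^sup>2 * d m - \<beta>\<close>.\<close>
  have grow: "d m < d (m + 2)" if "d m > 1" for m
  proof -
    have "\<beta> * (d (Suc m) + \<beta> * d m) < \<beta>"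
      using rec[of m] \<beta> by simp
    then have "\<beta>\<^sup>2 * d m - \<beta> < - (\<beta> * d (Suc m))"
      by (simp add: algebra_simps power2_eq_square)
    also have "\<dots> \<le> d (m + 2)"
      using rec[of "Suc m"] by simp
    finally have "\<beta>\<^sup>2 * d m - \<beta> < d (m + 2)" .
    moreover have "\<beta> * 1 \<le> (\<beta>\<^sup>2 - 1) * d m"
      using \<beta> that by (intro mult_mono) auto
    ultimately show ?thesis
      by (simp add: algebra_simps)
  qed
  have le: "d m \<le> 1" if "m \<ge> n0" for m
  proof (rule ccontr)
    assume "\<not> d m \<le> 1"
    then have gt: "d m > 1"
      by simp
    have inc: "d m < d (m + 2 * Suc k)" for k
    proof (induction k)
      case 0
      show ?case using grow[OF gt] by simp
    next
      case (Suc k)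
      then show ?case
        using grow[of "m + 2 * Suc k"] gt by simp
    qed
    \<comment> \<open>Growth is known only along steps of two and \<open>p\<close> may be odd, hence
      \<open>2 * p\<close>.\<close>
    have "d (m + 2 * p) = d m"
      using periodic_mult[of n0 d p m 2] per that by simp
    then show False
      using inc[of "p - 1"] \<open>p > 0\<close> by simp
  qed
  \<comment> \<open>A value below \<open>- 1\<close> is followed by one above
    \<open>\<beta>\<close>, which \<open>le\<close> excludes.\<close>
  have "- 1 \<le> d n"
  proof (rule ccontr)
    assume "\<not> - 1 \<le> d n"
    then have "\<beta> * d n < \<beta> * (- 1)"
      using \<beta> by (intro mult_strict_left_mono) auto
    then have "d (Suc n) > 1"
      using rec[of n] \<beta> by linarith
    then show False
      using le[of "Suc n"] \<open>n \<ge> n0\<close> by simp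
  qed
  then show ?thesis
    using le[OF \<open>n \<ge> n0\<close>] by simp
qed

text \<open>Monotonicity over the rest of a period closes up:
  \<open>f (Suc n) \<le> f (n + p) = f n\<close>.\<close>

lemma periodic_nondecreasing_constant:
  fixes f :: "nat \<Rightarrow> 'a :: order"
  assumes "\<And>n. n \<ge> n0 \<Longrightarrow> f (n + p) = f n" and "p > 0"
    and mono: "\<And>n. n \<ge> n0 \<Longrightarrow> f n \<le> f (Suc n)" and "n \<ge> n0"
  shows "f (Suc n) = f n"
proof (rule antisym)
  have "f (Suc n) \<le> f (Suc n + k)" for k
    by (induction k) (use mono \<open>n \<ge> n0\<close> in \<open>auto intro: order_trans\<close>)
  from this[of "p - 1"] show "f (Suc n) \<le> f n"
    using assms by simp
qed (use assms in simp)

lemma periodic_expanding_zero: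
  fixes s :: "nat \<Rightarrow> int" and \<alpha> \<beta> :: real
  assumes per: "\<And>n. n \<ge> n0 \<Longrightarrow> s (n + p) = s n" and "p > 0"
    and rec: "\<And>n. s (n + 2) = - \<lfloor>\<alpha> * \<beta> * s n + (\<alpha> + \<beta>) * s (n + 1)\<rfloor>"
    and \<alpha>: "\<alpha> > 1" and \<beta>: "\<beta> > 1" "\<beta>\<^sup>2 - 1 \<ge> \<beta>" and "n \<ge> n0"
  shows "s n = 0"
proof -
  have step: "0 \<le> \<alpha> * \<beta> * s m + (\<alpha> + \<beta>) * s (Suc m) + s (Suc (Suc m)) \<and>
      \<alpha> * \<beta> * s m + (\<alpha> + \<beta>) * s (Suc m) + s (Suc (Suc m)) < 1" for m
    using rec[of m] by simp linarith
  define d where "d m = s (Suc m) + \<alpha> * s m" for m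
  have d: "\<bar>d m\<bar> \<le> 1" if "m \<ge> n0" for m
  proof (rule periodic_expanding_bounded[OF _ \<open>p > 0\<close> _ \<beta> that])
    show "d (k + p) = d k" if "k \<ge> n0" for k
      using per[of k] per[of "Suc k"] that by (simp add: d_def)
    show "0 \<le> d (Suc k) + \<beta> * d k \<and> d (Suc k) + \<beta> * d k < 1" for k
      using step[of k] by (simp add: d_def algebra_simps)
  qed
  have mono: "\<bar>s m\<bar> \<le> \<bar>s (Suc m)\<bar>" if "m \<ge> n0" for m
  proof (cases "s m = 0")
    case False
    have "\<alpha> * \<bar>real_of_int (s m)\<bar> \<le> \<bar>real_of_int (s (Suc m))\<bar> + 1"
      using d[OF that] \<alpha> abs_triangle_ineq4[of "d m" "s (Suc m)"] by (simp add: d_def abs_mult)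
    \<comment> \<open>Strictness yields \<open>\<bar>s m\<bar> < \<bar>s (Suc m)\<bar> + 1\<close>,
      and integrality removes the \<open>1\<close>.\<close>
    moreover have "1 * \<bar>real_of_int (s m)\<bar> < \<alpha> * \<bar>real_of_int (s m)\<bar>"
      using \<alpha> False by (intro mult_strict_right_mono) auto
    ultimately show ?thesis
      by linarith
  qed simp
  have alt: "s (Suc m) = - s m" if "m \<ge> n0" for m
  proof -
    have "\<bar>s (Suc m)\<bar> = \<bar>s m\<bar>"
      using periodic_nondecreasing_constant[of n0 "\<lambda>k. \<bar>s k\<bar>" p m] per mono \<open>p > 0\<close> that by simp
    then consider "s (Suc m) = - s m" | "s (Suc m) = s m" "s m \<noteq> 0"
      by linarith
    then show ?thesis
    proof cases
      \<comment> \<open>Equal signs reinforce each other in \<open>d m\<close>, pushing it beyond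
        the bound \<open>1\<close>.\<close>
      case 2
      then have "d m = (1 + \<alpha>) * s m"
        by (simp add: d_def distrib_right)
      then have "\<bar>d m\<bar> = (1 + \<alpha>) * \<bar>real_of_int (s m)\<bar>"
        using \<alpha> by (simp add: abs_mult)
      moreover have "(1 + \<alpha>) * 1 \<le> (1 + \<alpha>) * \<bar>real_of_int (s m)\<bar>"
        using \<alpha> 2 by (intro mult_left_mono) linarith+
      ultimately have "1 + \<alpha> \<le> \<bar>d m\<bar>"
        by simp
      then have False
        using d[OF that] \<alpha> by linarith
      then show ?thesis ..
    qed
  qed
  \<comment> \<open>On an alternating sequence the left side of the recursion factors; used at
    \<open>n\<close> and \<open>Suc n\<close>, this bounds both \<open>s n\<close> and
    \<open>- s n\<close> below by \<open>0\<close>.\<close>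
  have "0 \<le> (\<alpha> - 1) * (\<beta> - 1) * s m" if "m \<ge> n0" for m
    using step[of m] alt[of m] alt[of "Suc m"] that by (simp add: algebra_simps)
  moreover have "0 < (\<alpha> - 1) * (\<beta> - 1)"
    using \<alpha> \<beta> by simp
  ultimately have "0 \<le> s m" if "m \<ge> n0" for m
    using that by (metis mult_pos_neg not_less of_int_0_le_iff)
  from this[of n] this[of "Suc n"] show ?thesis
    using alt[of n] \<open>n \<ge> n0\<close> by simp
qed

theorem theorem6:
  shows "{(r0 :: real, r1 :: real). - 1 < r0 - r1 \<and> r0 - r1 \<le> - (1 / 2) \<and>
           r1 \<ge> 1 + sqrt 5 \<and> r1\<^sup>2 \<ge> 4 * r0} \<subseteq> D2_star"
proof clarify
  fix r0 r1 :: real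
  assume r: "- 1 < r0 - r1" "r1 \<ge> 1 + sqrt 5" and disc: "4 * r0 \<le> r1\<^sup>2"
  define \<beta> where "\<beta> = (r1 + sqrt (r1\<^sup>2 - 4 * r0)) / 2"
  define \<alpha> where "\<alpha> = r1 - \<beta>"
  have sum: "\<alpha> + \<beta> = r1"
    by (simp add: \<alpha>_def)
  have prod: "\<alpha> * \<beta> = r0"
    using disc by (simp add: \<alpha>_def \<beta>_def field_simps power2_eq_square)
  have golden: "\<beta> \<ge> (1 + sqrt 5) / 2"
    using r disc by (simp add: \<beta>_def add_increasing2)
  have "1 < (1 + sqrt 5) / 2"
    by simp
  with golden have \<beta>: "\<beta> > 1"
    by (rule less_le_trans[rotated])
  \<comment> \<open>Completing the square: \<open>(2 * \<beta> - 1)\<^sup>2 - 5 = 4 *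
    (\<beta>\<^sup>2 - \<beta> - 1)\<close>.\<close>
  have "(sqrt 5)\<^sup>2 \<le> (2 * \<beta> - 1)\<^sup>2"
    using golden by (intro power_mono) auto
  then have \<beta>2: "\<beta>\<^sup>2 - 1 \<ge> \<beta>"
    by (simp add: power2_eq_square algebra_simps)
  have "0 < (\<alpha> - 1) * (\<beta> - 1)"
    using r(1) by (simp add: algebra_simps flip: sum prod)
  with \<beta> have \<alpha>: "\<alpha> > 1"
    by (simp add: zero_less_mult_iff)
  show "(r0, r1) \<in> D2_star"
    unfolding D2_star_def
  proof (intro CollectI allI impI)
    fix a
    assume "ultimately_periodic (srs_orbit (r0, r1) a)"
    then obtain n0 p where "p > 0"
      and "\<And>n. n \<ge> n0 \<Longrightarrow> srs_orbit (r0, r1) a (n + p) = srs_orbit (r0, r1) a n"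
      unfolding ultimately_periodic_def by blast
    then have "srs_orbit (r0, r1) a n = 0" if "n \<ge> n0" for n
      using periodic_expanding_zero[of n0 "srs_orbit (r0, r1) a" p \<alpha> \<beta> n] \<alpha> \<beta> \<beta>2 that
        srs_orbit_rec[of "(r0, r1)" a] by (simp add: sum prod)
    then show "ends_in_trivial_cycle (srs_orbit (r0, r1) a)"
      unfolding ends_in_trivial_cycle_def by blast
  qed
qed

end
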